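(* Let $k_0,k_1,\dots,k_m$ be positive real numbers, let $q\in(0,1)$, and let $\Sigma=\{\sum_{i=0}^m\varepsilon_ik_i:\varepsilon_i\in\{0,1\}\}$. Assume that $E(k_0,k_1,\dots,k_m;q)$ has non-empty interior in $\mathbb{R}$. If, for some integer $k\ge 0$, $U(\Sigma+\Sigma q+\dots+\Sigma q^k)\neq\Sigma+\Sigma q+\dots+\Sigma q^k$, then $U(k_0,k_1,\dots,k_m;q)$ is nowhere dense in $\mathbb{R}$.
   Context: The multigeometric sequence $(k_0,\dots,k_m;q)$ is $(k_0,\dots,k_m,k_0q,\dots,k_mq,k_0q^2,\dots,k_mq^2,\dots)$. For a summable sequence $(x_n)$ of positive reals, $E(x_n)=\{\sum_{n\in A}x_n:A\subset\mathbb{N}\}$ and $U(x_n)$ is the set of $x\in E(x_n)$ for which exactly one $A\subset\mathbb{N}$ satisfies $x=\sum_{n\in A}x_n$; $E(k_0,\dots,k_m;q)$ and $U(k_0,\dots,k_m;q)$ denote these sets for the multigeometric sequence, so that $E(k_0,\dots,k_m;q)=\{\sum_{n=0}^\infty a_nq^n:(a_n)\in\Sigma^{\mathbb{N}_0}\}$, where $\mathbb{N}_0=\{0,1,2,\dots\}$. The set $\Sigma+\Sigma q+\dots+\Sigma q^k$ consists of all sums $\sum_{j=0}^k\sum_{i=0}^m\varepsilon_{i,j}k_iq^j$ with $\varepsilon_{i,j}\in\{0,1\}$, and $U(\Sigma+\Sigma q+\dots+\Sigma q^k)$ is the set of those of its points that are represented in this form by exactly one array $(\varepsilon_{i,j})\in\{0,1\}^{(m+1)(k+1)}$.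 *)

theory Defs
  imports "HOL-Analysis.Analysis"
begin

definition subsums :: "(nat \<Rightarrow> real) \<Rightarrow> real set"
  where "subsums x = range (infsum x)"

definition unique_subsums :: "(nat \<Rightarrow> real) \<Rightarrow> real set"
  where "unique_subsums x = {s \<in> subsums x. \<exists>!A. s = infsum x A}"

(* The paper's k_0, ..., k_m is a function k of which only the values k i with i \<le> m matter.
   Position n = j * (m + 1) + i, with i \<le> m, carries the term k_i q^j. *)
definition multigeometric :: "nat \<Rightarrow> (nat \<Rightarrow> real) \<Rightarrow> real \<Rightarrow> nat \<Rightarrow> real"
  where "multigeometric m k q n = k (n mod Suc m) * q ^ (n div Suc m)"

definition E_set :: "nat \<Rightarrow> (nat \<Rightarrow> real) \<Rightarrow> real \<Rightarrow> real set"
  where "E_set m k q = subsums (multigeometric m k q)"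

definition U_set :: "nat \<Rightarrow> (nat \<Rightarrow> real) \<Rightarrow> real \<Rightarrow> real set"
  where "U_set m k q = unique_subsums (multigeometric m k q)"

definition Sigma_set :: "nat \<Rightarrow> (nat \<Rightarrow> real) \<Rightarrow> real set"
  where "Sigma_set m k = {(\<Sum>i\<le>m. \<epsilon> i * k i) | \<epsilon>. \<epsilon> \<in> {..m} \<rightarrow>\<^sub>E {0, 1}}"

(* Extensional functions, so that counting arrays counts their entries on {..m} \<times> {..l} only. *)
definition arrays :: "nat \<Rightarrow> nat \<Rightarrow> (nat \<times> nat \<Rightarrow> real) set"
  where "arrays m l = {..m} \<times> {..l} \<rightarrow>\<^sub>E {0, 1}"

definition array_sum :: "nat \<Rightarrow> (nat \<Rightarrow> real) \<Rightarrow> real \<Rightarrow> nat \<Rightarrow> (nat \<times> nat \<Rightarrow> real) \<Rightarrow> real"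
  where "array_sum m k q l \<epsilon> = (\<Sum>j\<le>l. \<Sum>i\<le>m. \<epsilon> (i, j) * k i * q ^ j)"

(* The set \<Sigma> + \<Sigma> q + ... + \<Sigma> q^l; see Sigma_sum_eq. *)
definition Sigma_sum :: "nat \<Rightarrow> (nat \<Rightarrow> real) \<Rightarrow> real \<Rightarrow> nat \<Rightarrow> real set"
  where "Sigma_sum m k q l = array_sum m k q l ` arrays m l"

definition U_Sigma_sum :: "nat \<Rightarrow> (nat \<Rightarrow> real) \<Rightarrow> real \<Rightarrow> nat \<Rightarrow> real set"
  where "U_Sigma_sum m k q l =
    {s \<in> Sigma_sum m k q l. \<exists>!\<epsilon>. \<epsilon> \<in> arrays m l \<and> s = array_sum m k q l \<epsilon>}"

definition nowhere_dense :: "real set \<Rightarrow> bool"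
  where "nowhere_dense S \<longleftrightarrow> interior (closure S) = {}"

lemma Sigma_sum_eq:
  "Sigma_sum m k q l = {(\<Sum>j\<le>l. a j * q ^ j) | a. \<forall>j\<le>l. a j \<in> Sigma_set m k}"
proof (intro equalityI subsetI)
  fix s assume "s \<in> Sigma_sum m k q l"
  then obtain e where e: "e \<in> arrays m l" "s = array_sum m k q l e"
    by (auto simp: Sigma_sum_def)
  define a where "a j = (\<Sum>i\<le>m. e (i, j) * k i)" for j
  have "a j \<in> Sigma_set m k" if "j \<le> l" for j
    unfolding Sigma_set_def a_def
    by (rule CollectI, rule exI[of _ "restrict (\<lambda>i. e (i, j)) {..m}"])
      (use e(1) that in \<open>auto simp: arrays_def PiE_iff\<close>)
  moreover have "s = (\<Sum>j\<le>l. a j * q ^ j)"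
    by (simp add: e(2) array_sum_def a_def sum_distrib_right)
  ultimately show "s \<in> {(\<Sum>j\<le>l. a j * q ^ j) | a. \<forall>j\<le>l. a j \<in> Sigma_set m k}"
    by blast
next
  fix s assume "s \<in> {(\<Sum>j\<le>l. a j * q ^ j) | a. \<forall>j\<le>l. a j \<in> Sigma_set m k}"
  then obtain a where a: "s = (\<Sum>j\<le>l. a j * q ^ j)" "\<forall>j\<le>l. a j \<in> Sigma_set m k"
    by blast
  have "\<forall>j. \<exists>d. j \<le> l \<longrightarrow> d \<in> {..m} \<rightarrow>\<^sub>E {0, 1} \<and> a j = (\<Sum>i\<le>m. d i * k i)"
    using a(2) unfolding Sigma_set_def by blast
  then obtain d where
    d: "\<And>j. j \<le> l \<Longrightarrow> d j \<in> {..m} \<rightarrow>\<^sub>E {0, 1} \<and> a j = (\<Sum>i\<le>m. d j i * k i)"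
    by metis
  define e where "e = restrict (\<lambda>(i, j). d j i) ({..m} \<times> {..l})"
  have "e \<in> arrays m l"
    using d by (fastforce simp: e_def arrays_def PiE_iff)
  moreover have "array_sum m k q l e = s"
    unfolding array_sum_def a(1)
    by (rule sum.cong) (auto simp: d e_def sum_distrib_right intro!: sum.cong)
  ultimately show "s \<in> Sigma_sum m k q l"
    by (auto simp: Sigma_sum_def)
qed

(* infsum yields 0 on families that are not summable; this does not happen here. *)
lemma multigeometric_summable_on:
  assumes "0 < q" and "q < 1"
  shows "multigeometric m k q summable_on A"
proof -
  have S: "multigeometric m k q summable_on UNIV"
  proof -
    let ?g = "\<lambda>(j, i). k i * q ^ j :: real"
    have geo: "(\<lambda>j. q ^ j) summable_on UNIV"
      using assms by (intro norm_summable_imp_summable_on) (simp add: summable_geometric)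
    define f where "f n = (n div Suc m, n mod Suc m)" for n
    have inj: "inj f"
      by (rule injI) (metis f_def Pair_inject div_mult_mod_eq)
    have rng: "range f \<subseteq> UNIV \<times> {..m}"
      by (auto simp: f_def less_Suc_eq_le[symmetric])
    have "(\<lambda>p. ?g p) summable_on (UNIV \<times> {..m})"
    proof -
      have "?g summable_on (\<Union>i\<in>{..m}. UNIV \<times> {i})"
      proof (rule summable_on_finite_union_disjoint)
        fix i assume "i \<in> {..m}"
        have "(\<lambda>j. k i * q ^ j) summable_on UNIV"
          using geo by (rule summable_on_cmult_right)
        then have "(?g \<circ> (\<lambda>j. (j, i))) summable_on UNIV"
          by (simp add: o_def)
        then have "?g summable_on range (\<lambda>j. (j, i))"
          by (subst summable_on_reindex) (auto simp: inj_on_def)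
        also have "range (\<lambda>j. (j, i)) = UNIV \<times> {i}"
          by auto
        finally show "?g summable_on UNIV \<times> {i}" .
      qed auto
      also have "(\<Union>i\<in>{..m}. UNIV \<times> {i}) = UNIV \<times> {..m}"
        by auto
      finally show ?thesis .
    qed
    then have "?g summable_on range f"
      using rng summable_on_subset_banach by blast
    then have "(?g \<circ> f) summable_on UNIV"
      using inj summable_on_reindex by blast
    moreover have "?g \<circ> f = multigeometric m k q"
      by (auto simp: f_def multigeometric_def)
    ultimately show ?thesis by simp
  qed
  then show ?thesis
    using summable_on_subset_banach by blast
qed

end

theory Submission
  imports Defs
begin

text \<open>
  The set \<open>E\<close> of subsums is self-similar: cutting an index set after the first \<open>N\<close> groups of
  \<open>m + 1\<close> indices shows that every point of \<open>E\<close> has the form \<open>d + q ^ N * z\<close>, where \<open>d\<close> is a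
  subsum of the first \<open>N\<close> groups and \<open>z \<in> E\<close>, and conversely all such points lie in \<open>E\<close>
  (\<open>infsum_prepend\<close>). Prefixing preserves ambiguity: if \<open>z\<close> has two representations, so has
  \<open>d + q ^ N * z\<close> (\<open>prepend_not_in_U\<close>).

  If the finite sum \<open>\<Sigma> + \<dots> + \<Sigma> q ^ l\<close> has a point \<open>s\<close> with two representations, then
  no point of \<open>s + q ^ (l + 1) E\<close> lies in \<open>U\<close>. As \<open>E\<close> has interior points, this copy
  contains a nonempty open set \<open>V\<close> (\<open>open_ambiguous_set\<close>).
  Now let \<open>x\<close> be a point of \<open>U\<close> in an open set \<open>I\<close> contained in the closure of \<open>U\<close>, and let
  \<open>d\<close> be the contribution of its first \<open>N\<close> groups. For large \<open>N\<close> the small copy \<open>d + q ^ N * V\<close>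
  is close to \<open>x\<close>, so it meets \<open>I\<close>, although it is open and disjoint from \<open>U\<close>, a contradiction.
\<close>

text \<open>The index set that agrees with \<open>D\<close> below \<open>p\<close> and continues with a copy of \<open>C\<close>
  translated by \<open>p\<close>.\<close>

definition prepend :: "nat \<Rightarrow> nat set \<Rightarrow> nat set \<Rightarrow> nat set"
  where "prepend p D C = D \<inter> {..<p} \<union> (+) p ` C"

lemma prepend_inject: "prepend p D B = prepend p D C \<longleftrightarrow> B = C"
proof
  assume "prepend p D B = prepend p D C"
  moreover have "S = {n. p + n \<in> prepend p D S}" for S
    by (auto simp: prepend_def)
  ultimately show "B = C"
    by metis
qed simp

lemma prepend_eq_prefix_iff: "prepend p B C = prepend p D C \<longleftrightarrow> B \<inter> {..<p} = D \<inter> {..<p}"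
proof
  assume "prepend p B C = prepend p D C"
  moreover have "S \<inter> {..<p} = prepend p S C \<inter> {..<p}" for S
    by (auto simp: prepend_def)
  ultimately show "B \<inter> {..<p} = D \<inter> {..<p}"
    by metis
qed (simp add: prepend_def)

lemma prepend_split: "prepend p A {n. p + n \<in> A} = A"
proof -
  have "n \<in> (+) p ` {n. p + n \<in> A}" if "n \<in> A" "\<not> n < p" for n
    using that by (intro image_eqI[of _ _ "n - p"]) auto
  then show ?thesis
    unfolding prepend_def by auto
qed

lemma multigeometric_shift:
  "multigeometric m k q (N * Suc m + n) = q ^ N * multigeometric m k q n"
  unfolding multigeometric_def by (simp add: power_add del: mult_Suc_right)

lemma multigeometric_nonneg:
  assumes "\<forall>i\<le>m. 0 < k i" and "0 < q"
  shows "0 \<le> multigeometric m k q n"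
proof -
  have "n mod Suc m \<le> m"
    by (simp add: less_Suc_eq_le[symmetric])
  then show ?thesis
    using assms by (simp add: multigeometric_def less_imp_le)
qed

lemma infsum_prepend:
  assumes "0 < q" and "q < 1"
  shows "infsum (multigeometric m k q) (prepend (N * Suc m) D C) =
    infsum (multigeometric m k q) (D \<inter> {..<N * Suc m}) + q ^ N * infsum (multigeometric m k q) C"
proof -
  let ?x = "multigeometric m k q" and ?p = "N * Suc m"
  have "infsum ?x (prepend ?p D C) = infsum ?x (D \<inter> {..<?p}) + infsum ?x ((+) ?p ` C)"
    unfolding prepend_def
    by (rule infsum_Un_disjoint) (auto simp: multigeometric_summable_on assms)
  also have "infsum ?x ((+) ?p ` C) = infsum (\<lambda>n. q ^ N * ?x n) C"
    by (subst infsum_reindex) (simp_all only: o_def multigeometric_shift inj_on_add)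
  also have "\<dots> = q ^ N * infsum ?x C"
    by (rule infsum_cmult_right) (simp add: multigeometric_summable_on assms)
  finally show ?thesis .
qed

lemma not_unique_subsums:
  assumes "infsum x A = s" and "infsum x B = s" and "A \<noteq> B"
  shows "s \<notin> unique_subsums x"
  using assms unfolding unique_subsums_def mem_Collect_eq by metis

lemma prepend_not_in_U:
  assumes "0 < q" and "q < 1" and z: "z \<in> E_set m k q" "z \<notin> U_set m k q"
  shows "infsum (multigeometric m k q) (D \<inter> {..<N * Suc m}) + q ^ N * z \<notin> U_set m k q"
proof -
  obtain A B where AB: "z = infsum (multigeometric m k q) A"
      "z = infsum (multigeometric m k q) B" "A \<noteq> B"
    using z unfolding E_set_def U_set_def unique_subsums_def subsums_def by blast
  show ?thesis
    unfolding U_set_def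
  proof (rule not_unique_subsums)
    show "prepend (N * Suc m) D A \<noteq> prepend (N * Suc m) D B"
      using AB(3) by (simp add: prepend_inject)
  qed (simp_all only: infsum_prepend[OF assms(1,2)] AB(1,2)[symmetric])
qed

text \<open>A 0-1 array is the indicator of an index set below \<open>(l + 1) * (m + 1)\<close>, and array sums are
  the corresponding subsums.\<close>

definition array_support :: "nat \<Rightarrow> nat \<Rightarrow> (nat \<times> nat \<Rightarrow> real) \<Rightarrow> nat set"
  where "array_support m l e = {n. n < Suc l * Suc m \<and> e (n mod Suc m, n div Suc m) = 1}"

lemma infsum_array_support:
  assumes "e \<in> arrays m l"
  shows "infsum (multigeometric m k q) (array_support m l e) = array_sum m k q l e"
proof -
  let ?x = "multigeometric m k q"
  let ?g = "\<lambda>n. e (n mod Suc m, n div Suc m) * ?x n"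
  have e01: "e (n mod Suc m, n div Suc m) \<in> {0, 1}" if "n < Suc l * Suc m" for n
  proof -
    have "n div Suc m < Suc l" "n mod Suc m < Suc m"
      using that by (simp_all add: less_mult_imp_div_less)
    then show ?thesis
      using assms unfolding arrays_def
      by (intro PiE_mem[of e]) (auto simp: less_Suc_eq_le)
  qed
  have "infsum ?x (array_support m l e) = (\<Sum>n\<in>array_support m l e. ?x n)"
    by (simp add: array_support_def)
  also have "\<dots> = (\<Sum>n<Suc l * Suc m. ?g n)"
    using e01 by (intro sum.mono_neutral_cong_left) (auto simp: array_support_def)
  also have "\<dots> = (\<Sum>j<Suc l. \<Sum>n=j * Suc m..<j * Suc m + Suc m. ?g n)"
    by (rule sum.nat_group[symmetric])
  also have "\<dots> = (\<Sum>j<Suc l. \<Sum>i<Suc m. e (i, j) * k i * q ^ j)"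
  proof (rule sum.cong[OF refl])
    fix j
    have "(\<Sum>n=j * Suc m..<j * Suc m + Suc m. ?g n) = (\<Sum>i<Suc m. ?g (i + j * Suc m))"
      using sum.shift_bounds_nat_ivl[of ?g 0 "j * Suc m" "Suc m"]
      by (simp add: add.commute lessThan_atLeast0)
    also have "\<dots> = (\<Sum>i<Suc m. e (i, j) * k i * q ^ j)"
    proof (rule sum.cong[OF refl])
      fix i assume "i \<in> {..<Suc m}"
      then have "(i + j * Suc m) mod Suc m = i" "(i + j * Suc m) div Suc m = j"
        by (simp_all del: mult_Suc_right)
      then show "?g (i + j * Suc m) = e (i, j) * k i * q ^ j"
        unfolding multigeometric_def by simp
    qed
    finally show "(\<Sum>n=j * Suc m..<j * Suc m + Suc m. ?g n)
      = (\<Sum>i<Suc m. e (i, j) * k i * q ^ j)" .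
  qed
  also have "\<dots> = array_sum m k q l e"
    by (simp only: array_sum_def lessThan_Suc_atMost)
  finally show ?thesis .
qed

lemma inj_on_array_support: "inj_on (array_support m l) (arrays m l)"
proof (rule inj_onI)
  fix e f assume e: "e \<in> arrays m l" and f: "f \<in> arrays m l"
    and eq: "array_support m l e = array_support m l f"
  show "e = f"
  proof (rule PiE_ext[OF e[unfolded arrays_def] f[unfolded arrays_def]])
    fix p assume p: "p \<in> {..m} \<times> {..l}"
    obtain i j where ij: "p = (i, j)" "i < Suc m" "j < Suc l"
      using p by auto
    define n where "n = i + j * Suc m"
    have n: "n mod Suc m = i" "n div Suc m = j"
      using ij unfolding n_def by (simp_all del: mult_Suc_right)
    have "n < Suc j * Suc m"
      using ij(2) by (simp add: n_def)
    also have "\<dots> \<le> Suc l * Suc m"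
      using ij(3) by (intro mult_le_mono1) simp
    finally have "n < Suc l * Suc m" .
    then have "n \<in> array_support m l g \<longleftrightarrow> g p = 1" for g
      unfolding array_support_def mem_Collect_eq n ij(1) by simp
    then have "e p = 1 \<longleftrightarrow> f p = 1"
      using eq by metis
    moreover have "e p \<in> {0, 1}" "f p \<in> {0, 1}"
      using e f p unfolding arrays_def by (blast intro: PiE_mem)+
    ultimately show "e p = f p"
      by auto
  qed
qed

lemma open_ambiguous_set:
  assumes q: "0 < q" "q < 1"
    and int: "interior (E_set m k q) \<noteq> {}"
    and amb: "U_Sigma_sum m k q l \<noteq> Sigma_sum m k q l"
  obtains V where "open V" "V \<noteq> {}" "V \<subseteq> E_set m k q" "V \<inter> U_set m k q = {}"
proof -
  let ?x = "multigeometric m k q" and ?p = "Suc l * Suc m"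
  obtain e f where e: "e \<in> arrays m l" and f: "f \<in> arrays m l" and "e \<noteq> f"
    and ef: "array_sum m k q l e = array_sum m k q l f"
    using amb unfolding U_Sigma_sum_def Sigma_sum_def by blast
  define s where "s = array_sum m k q l e"
  define B where "B = array_support m l e"
  define C where "C = array_support m l f"
  have below: "B \<inter> {..<?p} = B" "C \<inter> {..<?p} = C"
    by (auto simp: B_def C_def array_support_def)
  have sum: "infsum ?x B = s" "infsum ?x C = s"
    using ef by (simp_all add: B_def C_def s_def infsum_array_support e f)
  have "B \<noteq> C"
    using inj_onD[OF inj_on_array_support _ e f] \<open>e \<noteq> f\<close> unfolding B_def C_def by blast
  have rep: "infsum ?x (prepend ?p B A) = s + q ^ Suc l * infsum ?x A"
      "infsum ?x (prepend ?p C A) = s + q ^ Suc l * infsum ?x A" for A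
    by (simp_all only: infsum_prepend[OF q] below sum)
  define V where "V = (\<lambda>z. s + q ^ Suc l * z) ` interior (E_set m k q)"
  have V: "y \<in> E_set m k q \<and> y \<notin> U_set m k q" if "y \<in> V" for y
  proof -
    obtain z where "z \<in> E_set m k q" and y: "y = s + q ^ Suc l * z"
      using \<open>y \<in> V\<close> interior_subset unfolding V_def by blast
    then obtain A where A: "z = infsum ?x A"
      unfolding E_set_def subsums_def by blast
    have "prepend ?p B A \<noteq> prepend ?p C A"
      using \<open>B \<noteq> C\<close> by (simp only: prepend_eq_prefix_iff below not_False_eq_True)
    then have "y \<notin> U_set m k q"
      unfolding U_set_def y A by (rule not_unique_subsums[OF rep])
    moreover have "y \<in> E_set m k q"
      unfolding E_set_def subsums_def y A rep(1)[symmetric] by simp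
    ultimately show ?thesis by blast
  qed
  have "V = (+) s ` ((*\<^sub>R) (q ^ Suc l) ` interior (E_set m k q))"
    by (auto simp: V_def)
  moreover have "open \<dots>"
    using q by (intro open_translation open_scaling) auto
  ultimately have "open V" by simp
  moreover have "V \<noteq> {}"
    using int by (simp add: V_def)
  ultimately show thesis
    using that V by blast
qed

theorem theorem5p12:
  fixes m :: nat and k :: "nat \<Rightarrow> real" and q :: real
  assumes "\<forall>i\<le>m. 0 < k i"
    and "0 < q" and "q < 1"
    and "interior (E_set m k q) \<noteq> {}"
    and "\<exists>l. U_Sigma_sum m k q l \<noteq> Sigma_sum m k q l"
  shows "nowhere_dense (U_set m k q)"
proof (rule ccontr)
  let ?x = "multigeometric m k q" and ?U = "U_set m k q"
  define I where "I = interior (closure ?U)"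
  assume "\<not> nowhere_dense ?U"
  then have I: "open I" "I \<noteq> {}" "I \<subseteq> closure ?U"
    using interior_subset by (auto simp: nowhere_dense_def I_def)
  obtain l where "U_Sigma_sum m k q l \<noteq> Sigma_sum m k q l"
    using assms(5) by blast
  then obtain V where V: "open V" "V \<noteq> {}" "V \<subseteq> E_set m k q" "V \<inter> ?U = {}"
    using open_ambiguous_set[OF assms(2-4)] by blast
  from I obtain x where x: "x \<in> I" "x \<in> ?U"
    using open_Int_closure_eq_empty[OF I(1), of ?U] by blast
  then obtain A where A: "x = infsum ?x A"
    unfolding U_set_def unique_subsums_def subsums_def by blast
  from V obtain v C where v: "v \<in> V" "v = infsum ?x C"
    unfolding E_set_def subsums_def by blast
  define T where "T = infsum ?x UNIV"
  have bounds: "0 \<le> infsum ?x S \<and> infsum ?x S \<le> T" for S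
    unfolding T_def
    by (intro conjI infsum_nonneg infsum_mono_neutral)
      (auto intro: multigeometric_summable_on multigeometric_nonneg[OF assms(1,2)] assms(2,3))
  obtain r where r: "r > 0" "ball x r \<subseteq> I"
    using I(1) x(1) open_contains_ball by blast
  have "(\<lambda>N. q ^ N * T) \<longlonglongrightarrow> 0"
    using assms by (intro tendsto_mult_left_zero LIMSEQ_power_zero) simp
  then obtain N where N: "q ^ N * T < r"
    using order_tendstoD(2)[of _ 0 sequentially r] r(1) eventually_happens by force
  define d where "d = infsum ?x (A \<inter> {..<N * Suc m})"
  define A' where "A' = {n. N * Suc m + n \<in> A}"
  have "x = d + q ^ N * infsum ?x A'"
    using infsum_prepend[OF assms(2,3), of m k N A A']
    by (simp only: A A'_def d_def prepend_split)
  then have "dist x (d + q ^ N * v) = q ^ N * \<bar>infsum ?x A' - infsum ?x C\<bar>"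
    using assms(2) by (simp add: v(2) dist_real_def right_diff_distrib[symmetric] abs_mult)
  also have "\<dots> \<le> q ^ N * T"
    using bounds[of A'] bounds[of C] assms(2) by (intro mult_left_mono) auto
  finally have "d + q ^ N * v \<in> I"
    using N r(2) by auto
  define W where "W = (\<lambda>z. d + q ^ N * z) ` V"
  have "W = (+) d ` ((*\<^sub>R) (q ^ N) ` V)"
    by (auto simp: W_def)
  moreover have "open \<dots>"
    using assms(2) V(1) by (intro open_translation open_scaling) auto
  ultimately have "open (W \<inter> I)"
    using I(1) by auto
  moreover have "W \<inter> I \<inter> closure ?U \<noteq> {}"
    using \<open>d + q ^ N * v \<in> I\<close> v(1) I(3) by (auto simp: W_def)
  ultimately have "W \<inter> ?U \<noteq> {}"
    using open_Int_closure_eq_empty by blast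
  then show False
    using V(3,4) prepend_not_in_U[OF assms(2,3)] unfolding W_def d_def by blast
qed

end
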